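(* Let $M$ be a random $n\times n$ matrix whose entries are i.i.d. with continuous cumulative distribution function $G$, let $Q=(M+M^T)/2$, and let $K_n$ be the support size of a global minimizer $\mathbf X^*$ of $\mathbf x^TQ\mathbf x$ over the standard simplex $\Delta_n$. Suppose that for some real $a$ and positive $b,c,\kappa$, $$G(x)=(c+O(|x|^{-\kappa}))\,|x|^a\exp(-|x|^b),\qquad x\to-\infty,$$ and that this asymptotic formula can be differentiated to yield an asymptotic formula for the density $g=G'$, namely $g(x)=(cb+O(|x|^{-\kappa}))|x|^{a+b-1}\exp(-|x|^b)$ as $x\to-\infty$. Let $b>1$ and $a':=2a+\frac b2$. Then, for all $k\le k_n$, $$\Pr\{K_n=k+1\}\le_b n\left(\frac89\right)^{k/4}+n\exp\left(-\frac{k\left(\log\frac nk\right)^{\min\{0,a'/b\}}}{2e}\right).$$ Consequently $K_n=O_p\bigl((\log n)^{\max(1,\,1/2-2a/b)}\bigr)$. So for the quasi-normal case $a=-1$, $b=2$ we have $K_n=O_p\bigl(\log^{3/2}n\bigr)$.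
   Context: $\Delta_n=\{\mathbf x\in\mathbb R^n:\ \mathbf x\ge \mathbf 0,\ \sum_{j}x_j=1\}$. $\mathbf X^*$ denotes a global minimum solution of the problem of minimizing $\mathbf x^TQ\mathbf x$ over $\Delta_n$, and $K_n=|\{j\in[n]: X^*_j>0\}|$. $k_n=\lceil\alpha n^{1/2}\rceil$, where $\alpha>e\sqrt2$ is a fixed constant. $L\le_b R$ means $L=O(R)$ as $n\to\infty$, uniformly over the stated range of $k$. $K_n=O_p(h(n))$ means that $\Pr(K_n>\omega(n)h(n))\to0$ for every $\omega(n)\to\infty$, however slowly. $\log^{s}n$ means $(\log n)^s$. *)

theory Defs
  imports "HOL-Probability.Probability" "HOL-Library.Landau_Symbols"
begin

text \<open>
  Since the dimension \<open>n\<close> varies, matrices are functions on pairs of indices, of which only the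
  entries with indices in \<open>{..<n}\<close> matter, and \<open>\<real>\<^sup>n\<close> is the set of sequences vanishing
  from index \<open>n\<close> on.
\<close>

definition std_simplex :: "nat \<Rightarrow> (nat \<Rightarrow> real) set" where
  "std_simplex n = {x. (\<forall>j<n. 0 \<le> x j) \<and> (\<forall>j\<ge>n. x j = 0) \<and> (\<Sum>j<n. x j) = 1}"

definition sym_part :: "(nat \<Rightarrow> nat \<Rightarrow> real) \<Rightarrow> nat \<Rightarrow> nat \<Rightarrow> real" where
  "sym_part A i j = (A i j + A j i) / 2"

definition quad_form :: "nat \<Rightarrow> (nat \<Rightarrow> nat \<Rightarrow> real) \<Rightarrow> (nat \<Rightarrow> real) \<Rightarrow> real" where
  "quad_form n Q x = (\<Sum>i<n. \<Sum>j<n. x i * Q i j * x j)"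

definition global_minimizer :: "nat \<Rightarrow> (nat \<Rightarrow> nat \<Rightarrow> real) \<Rightarrow> (nat \<Rightarrow> real) \<Rightarrow> bool" where
  "global_minimizer n Q x \<longleftrightarrow> is_arg_min (quad_form n Q) (\<lambda>y. y \<in> std_simplex n) x"

definition support_size :: "nat \<Rightarrow> (nat \<Rightarrow> real) \<Rightarrow> nat" where
  "support_size n x = card {j \<in> {..<n}. x j > 0}"

text \<open>\<open>f x = (c + O(\<bar>x\<bar>\<^sup>-\<^sup>\<kappa>)) \<bar>x\<bar>\<^sup>a exp (-\<bar>x\<bar>\<^sup>b)\<close> as \<open>x \<longlongrightarrow> -\<infinity>\<close>.\<close>

definition left_tail :: "(real \<Rightarrow> real) \<Rightarrow> real \<Rightarrow> real \<Rightarrow> real \<Rightarrow> real \<Rightarrow> bool" where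
  "left_tail f c \<kappa> a b \<longleftrightarrow>
     (\<exists>\<delta>. \<delta> \<in> O[at_bot](\<lambda>x. \<bar>x\<bar> powr (-\<kappa>)) \<and>
        (\<forall>\<^sub>F x in at_bot. f x = (c + \<delta> x) * \<bar>x\<bar> powr a * exp (- (\<bar>x\<bar> powr b))))"

text \<open>\<open>Y\<^sub>n = O\<^sub>p(h(n))\<close>, where \<open>Y\<^sub>n\<close> is a random variable on \<open>P n\<close>.\<close>

definition bigO_prob ::
  "(nat \<Rightarrow> 'a measure) \<Rightarrow> (nat \<Rightarrow> 'a \<Rightarrow> real) \<Rightarrow> (nat \<Rightarrow> real) \<Rightarrow> bool" where
  "bigO_prob P Y h \<longleftrightarrow>
     (\<forall>w :: nat \<Rightarrow> real. filterlim w at_top sequentially \<longrightarrow>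
        (\<lambda>n. measure (P n) {\<omega> \<in> space (P n). Y n \<omega> > w n * h n}) \<longlonglongrightarrow> 0)"

definition k_max :: "real \<Rightarrow> nat \<Rightarrow> nat" where
  "k_max \<alpha> n = nat \<lceil>\<alpha> * sqrt (real n)\<rceil>"

end

theory Submission
  imports Defs "HOL-Real_Asymp.Real_Asymp"
begin

text \<open>
  Write \<open>Q\<close> for the symmetrised matrix, \<open>x\<close> for the minimizer and \<open>\<lambda>\<close> for the minimum. The
  proof gives the single estimate \<open>P (K\<^sub>n \<ge> k + 1) \<le> 3 n exp (- k)\<close>, uniformly for
  \<open>1 \<le> k \<le> k\<^sub>n\<close> and large \<open>n\<close>. It implies the bound on \<open>P (K\<^sub>n = k + 1)\<close>, since
  \<open>exp (- k) \<le> (8/9) powr (k/4)\<close>, and with \<open>k\<close> about \<open>2 log n\<close> it yields the estimates in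
  probability, whose rates all dominate \<open>log n\<close>.

  First order optimality says \<open>(Qx)\<^sub>i \<le> \<lambda>\<close> on the support, and comparing with the vertices
  gives \<open>\<lambda> \<le> Q\<^sub>i\<^sub>i\<close> for every \<open>i\<close>. Hence in every row of the support the off-diagonal entries,
  averaged with weights \<open>x\<^sub>j\<close>, are at most \<open>\<lambda>\<close>, and \<open>\<lambda>\<close> is at most the smallest of \<open>n\<close>
  diagonal entries. Let \<open>L = log (n/k)\<close>. Up to an error \<open>exp (- k)\<close> the smallest diagonal entry
  is at most \<open>- v\<close>, where \<open>v powr b\<close> is a little less than \<open>L\<close>. An off-diagonal entry is the
  average of two independent variables, and as \<open>b > 1\<close> convexity of \<open>t powr b\<close> roughly doubles
  the exponent: \<open>P (Q\<^sub>i\<^sub>j \<le> - y)\<close> is of order at most \<open>exp (- 3/2 y powr b)\<close>. So entries of size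
  \<open>- v\<close> off the diagonal are very rare.

  Fix \<open>w < v < B\<close>, constant multiples of \<open>L powr (1/b)\<close>. Entries below \<open>- B\<close> are so
  improbable that, up to an error \<open>exp (- k)\<close>, fewer than \<open>k/4\<close> pairs carry one. More than
  \<open>k/2\<close> rows of the support then have all their off-diagonal entries above \<open>- B\<close>, while their
  weighted average is at most \<open>- v\<close>; this forces a fixed fraction of the mass of \<open>x\<close> onto
  columns with entry at most \<open>- w\<close> (\<open>row_mass_of_negative_entries\<close>). Averaging over the rows
  with respect to \<open>x\<close> produces one column having a number proportional to \<open>k\<close> of entries at most
  \<open>- w\<close> (\<open>dense_column\<close>). Averaging turns the dependent weights \<open>x\<close> into a purely combinatorial
  pattern in \<open>Q\<close>, and a union bound over independent entries shows that each column contains this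
  pattern with probability at most \<open>exp (- k)\<close> (\<open>prob_dense_column\<close>). The three error terms are
  added up in \<open>prob_large_support\<close>, and \<open>eventually_thresholds\<close> supplies \<open>w\<close>, \<open>v\<close> and \<open>B\<close>.
\<close>

section \<open>Optimality conditions\<close>

text \<open>
  The curve starts at \<open>x\<close> and moves away from the vertex \<open>i\<close>. Besides small \<open>t > 0\<close>, which
  gives the first order condition, the value \<open>t = -1\<close> is of use: the curve is then at the
  vertex itself.
\<close>

lemma quad_form_away_from_vertex:
  assumes sym: "\<And>l j. Q l j = Q j l" and i: "i < n"
  shows "quad_form n Q (\<lambda>j. (1 + t) * x j - (if j = i then t else 0)) =
    (1 + t)\<^sup>2 * quad_form n Q x - 2 * t * (1 + t) * (\<Sum>j<n. Q i j * x j) + t\<^sup>2 * Q i i"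
proof -
  define R where "R l = (\<Sum>j<n. Q l j * x j)" for l
  define y where "y j = (1 + t) * x j - (if j = i then t else 0)" for j
  have pick: "(\<Sum>j<n. f j * (if j = i then t else 0)) = f i * t" for f :: "nat \<Rightarrow> real"
    using i by (simp add: if_distrib cong: if_cong)
  have qf: "quad_form n Q z = (\<Sum>l<n. z l * (\<Sum>j<n. Q l j * z j))" for z
    unfolding quad_form_def by (simp add: sum_distrib_left mult.assoc)
  have Qy: "(\<Sum>j<n. Q l j * y j) = (1 + t) * R l - t * Q l i" for l
  proof -
    have "(\<Sum>j<n. Q l j * y j) = (1 + t) * R l - (\<Sum>j<n. Q l j * (if j = i then t else 0))"
      unfolding y_def R_def by (simp add: algebra_simps sum_subtractf sum.distrib sum_distrib_left)
    then show ?thesis by (simp add: pick mult.commute)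
  qed
  have col: "(\<Sum>l<n. x l * Q l i) = R i"
    unfolding R_def by (rule sum.cong) (simp_all add: sym mult.commute)
  have xl: "(\<Sum>l<n. x l * ((1 + t) * R l - t * Q l i)) = (1 + t) * quad_form n Q x - t * R i"
  proof -
    have "(\<Sum>l<n. x l * ((1 + t) * R l - t * Q l i)) =
        (1 + t) * (\<Sum>l<n. x l * R l) - t * (\<Sum>l<n. x l * Q l i)"
      by (simp add: algebra_simps sum_subtractf sum.distrib sum_distrib_left)
    then show ?thesis by (simp add: col qf[of x] R_def)
  qed
  have "quad_form n Q y = (\<Sum>l<n. y l * ((1 + t) * R l - t * Q l i))"
    by (simp add: qf Qy)
  also have "\<dots> = (1 + t) * (\<Sum>l<n. x l * ((1 + t) * R l - t * Q l i))
      - (\<Sum>l<n. ((1 + t) * R l - t * Q l i) * (if l = i then t else 0))"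
    unfolding sum_distrib_left sum_subtractf[symmetric]
    by (rule sum.cong) (simp_all add: y_def algebra_simps)
  also have "\<dots> = (1 + t)\<^sup>2 * quad_form n Q x - 2 * t * (1 + t) * R i + t\<^sup>2 * Q i i"
    by (simp only: xl pick) (simp add: algebra_simps power2_eq_square)
  finally show ?thesis unfolding y_def[abs_def] R_def .
qed

lemma minimizer_le_diag:
  assumes min: "global_minimizer n Q x" and sym: "\<And>l j. Q l j = Q j l" and i: "i < n"
  shows "quad_form n Q x \<le> Q i i"
proof -
  define y where "y = (\<lambda>j. (1 + (-1)) * x j - (if j = i then -1 else 0 :: real))"
  have "y \<in> std_simplex n"
    using i by (auto simp: std_simplex_def y_def if_distrib[of uminus] cong: if_cong)
  moreover have "quad_form n Q y = Q i i"
    unfolding y_def quad_form_away_from_vertex[OF sym i, where t = "-1" and x = x] by simp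
  ultimately show ?thesis
    using min by (force simp: global_minimizer_def is_arg_min_linorder)
qed

text \<open>
  At a minimizer this is an equality, but the proof needs only the inequality obtained by letting
  mass flow out of a coordinate of the support, a move which stays in the simplex for short time.
\<close>

lemma minimizer_row_le:
  assumes min: "global_minimizer n Q x" and sym: "\<And>l j. Q l j = Q j l"
    and i: "i < n" and pos: "x i > 0"
  shows "(\<Sum>j<n. Q i j * x j) \<le> quad_form n Q x"
proof (rule ccontr)
  define R where "R = (\<Sum>j<n. Q i j * x j)"
  define q where "q = quad_form n Q x"
  define D where "D = q - 2 * R + Q i i"
  assume "\<not> ?thesis"
  then have lt: "q < R" by (simp add: R_def q_def)
  define t where "t = min (x i) ((R - q) / (\<bar>D\<bar> + 1))"
  have t0: "t > 0" using pos lt by (simp add: t_def)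
  have x: "x \<in> std_simplex n" using min by (simp add: global_minimizer_def is_arg_min_def)
  let ?y = "\<lambda>j. (1 + t) * x j - (if j = i then t else 0)"
  have "t \<le> x i" by (simp add: t_def)
  moreover have "0 \<le> t * x i" using t0 pos by simp
  ultimately have "(1 + t) * x i - t \<ge> 0" by (simp add: algebra_simps)
  then have "?y \<in> std_simplex n"
    using x t0 i by (auto simp: std_simplex_def sum_subtractf sum_distrib_left[symmetric])
  then have "q \<le> quad_form n Q ?y"
    using min by (force simp: q_def global_minimizer_def is_arg_min_linorder)
  also have "\<dots> = (1 + t)\<^sup>2 * q - 2 * t * (1 + t) * R + t\<^sup>2 * Q i i"
    unfolding quad_form_away_from_vertex[OF sym i] by (simp add: q_def R_def)
  also have "\<dots> = q + t * (2 * (q - R) + t * D)"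
    by (simp add: D_def power2_eq_square algebra_simps)
  finally have "0 \<le> 2 * (q - R) + t * D"
    using t0 by (simp add: zero_le_mult_iff)
  moreover have "t * D \<le> R - q"
  proof -
    have "t * D \<le> t * (\<bar>D\<bar> + 1)" using t0 by (intro mult_left_mono) auto
    also have "\<dots> \<le> (R - q) / (\<bar>D\<bar> + 1) * (\<bar>D\<bar> + 1)"
      by (intro mult_right_mono) (auto simp: t_def)
    finally show ?thesis by simp
  qed
  ultimately show False using lt by simp
qed

section \<open>From a large support to a column with many negative entries\<close>

text \<open>
  Dividing by \<open>1 - x\<^sub>i \<ge> 1/2\<close> turns the row into an average of the off-diagonal entries which
  is at most \<open>- v\<close>. Entries above \<open>- w\<close> cannot achieve this, and the others can compensate by
  at most \<open>B - w\<close> per unit of mass, so they carry mass at least \<open>(v - w) / (2 (B - w))\<close>.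
\<close>

lemma row_mass_of_negative_entries:
  fixes Q :: "nat \<Rightarrow> nat \<Rightarrow> real"
  assumes x: "x \<in> std_simplex n" and i: "i < n" and half: "x i \<le> 1 / 2"
    and row: "(\<Sum>j<n. Q i j * x j) \<le> lam" and diag: "lam \<le> Q i i"
    and lam: "lam \<le> - v" and wv: "w < v" and vB: "v < B"
    and bd: "\<And>j. j < n \<Longrightarrow> j \<noteq> i \<Longrightarrow> - B < Q i j"
  shows "(v - w) / (2 * (B - w)) \<le> (\<Sum>j \<in> {j \<in> {..<n}. j \<noteq> i \<and> Q i j \<le> - w}. x j)"
proof -
  let ?N = "{j \<in> {..<n}. j \<noteq> i \<and> Q i j \<le> - w}"
  let ?J = "{..<n} - {i}"
  have x0: "0 \<le> x j" if "j < n" for j using x that by (auto simp: std_simplex_def)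
  have x1: "(\<Sum>j<n. x j) = 1" using x by (auto simp: std_simplex_def)
  have J: "(\<Sum>j\<in>?J. x j) = 1 - x i" using i x1 by (simp add: sum_diff1)
  have "(\<Sum>j\<in>?J. Q i j * x j) = (\<Sum>j<n. Q i j * x j) - Q i i * x i"
    using i by (simp add: sum_diff1)
  also have "\<dots> \<le> lam - lam * x i"
    using row diag x0[OF i] by (intro diff_mono mult_right_mono) auto
  also have "\<dots> = lam * (1 - x i)" by (simp add: algebra_simps)
  also have "\<dots> \<le> - v * (1 - x i)"
    using half lam by (intro mult_right_mono) auto
  finally have up: "(\<Sum>j\<in>?J. Q i j * x j) \<le> - v * (1 - x i)" .
  \<comment> \<open>The left-hand side replaces each entry by \<open>- B\<close> or \<open>- w\<close>, whichever bounds it below.\<close>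
  have "- w * (1 - x i) - (B - w) * (\<Sum>j\<in>?N. x j) =
      (\<Sum>j\<in>?J. - w * x j - (B - w) * (if j \<in> ?N then x j else 0))"
  proof -
    have "(\<Sum>j\<in>?N. x j) = (\<Sum>j\<in>?J. if j \<in> ?N then x j else 0)"
      by (rule sum.mono_neutral_cong_left) auto
    then show ?thesis
      by (simp add: sum_subtractf sum_distrib_left[symmetric] J sum_negf)
  qed
  also have "\<dots> \<le> (\<Sum>j\<in>?J. Q i j * x j)"
  proof (rule sum_mono)
    fix j assume j: "j \<in> ?J"
    show "- w * x j - (B - w) * (if j \<in> ?N then x j else 0) \<le> Q i j * x j"
    proof (cases "j \<in> ?N")
      case True
      then have "- B * x j \<le> Q i j * x j"
        using j bd[of j] x0[of j] by (intro mult_right_mono) auto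
      with True show ?thesis by (simp add: algebra_simps)
    next
      case False
      with j have "- w * x j \<le> Q i j * x j"
        using x0[of j] by (intro mult_right_mono) auto
      with False show ?thesis by (simp only: if_False)
    qed
  qed
  finally have "(v - w) * (1 - x i) \<le> (B - w) * (\<Sum>j\<in>?N. x j)"
    using up by (simp add: algebra_simps)
  moreover have "(v - w) * (1 / 2) \<le> (v - w) * (1 - x i)"
    using half wv by (intro mult_left_mono) auto
  ultimately show ?thesis using wv vB by (simp add: field_simps)
qed

text \<open>
  Each row outside the few exceptional ones contributes a fixed mass of columns with entry at most
  \<open>- w\<close>. Since \<open>x\<close> is a probability vector, double counting the pairs (row, column) yields a
  column that meets the average, whatever the weights are.
\<close>

lemma dense_column:
  fixes Q :: "nat \<Rightarrow> nat \<Rightarrow> real"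
  assumes min: "global_minimizer n Q x" and sym: "\<And>l j. Q l j = Q j l"
    and supp: "k + 1 \<le> support_size n x"
    and l: "l < n" "Q l l \<le> - v" and wv: "w < v" and vB: "v < B"
    and few: "real (card {p \<in> {(i, j). i < j \<and> j < n}. Q (fst p) (snd p) \<le> - B}) < k / 4"
  shows "\<exists>j<n. (v - w) / (4 * (B - w)) * k \<le>
    card {i \<in> {i. i < n \<and> i \<noteq> j}. Q i j \<le> - w}"
proof (rule ccontr)
  define r where "r = (v - w) / (2 * (B - w))"
  have r: "r > 0" using wv vB by (simp add: r_def)
  define E where "E = {p \<in> {(i, j). i < j \<and> j < n}. Q (fst p) (snd p) \<le> - B}"
  define I where "I = {j \<in> {..<n}. x j > 0}"
  \<comment> \<open>Rows are lost for two reasons: a weight above one half, which at most one index has, or an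
    entry at most \<open>- B\<close>, where each such pair spoils two rows.\<close>
  define H where "H = {j \<in> I. x j > 1 / 2}"
  define G where "G = I - H - (fst ` E \<union> snd ` E)"
  define c where "c j = card {i \<in> {i. i < n \<and> i \<noteq> j}. Q i j \<le> - w}" for j
  assume "\<not> ?thesis"
  then have small: "real (c j) < r * (k / 2)" if "j < n" for j
    using that by (auto simp: c_def r_def not_le)
  have x: "x \<in> std_simplex n" using min by (simp add: global_minimizer_def is_arg_min_def)
  have x0: "0 \<le> x j" if "j < n" for j using x that by (auto simp: std_simplex_def)
  have x1: "(\<Sum>j<n. x j) = 1" using x by (auto simp: std_simplex_def)
  have finI: "finite I" by (simp add: I_def)
  have finE: "finite E"
    by (rule finite_subset[of _ "{..<n} \<times> {..<n}"]) (auto simp: E_def)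
  have "card H \<le> 1"
  proof (rule ccontr)
    assume "\<not> card H \<le> 1"
    then obtain p q where pq: "p \<in> H" "q \<in> H" "p \<noteq> q"
      by (metis card_le_Suc0_iff_eq One_nat_def H_def finI finite_Collect_conjI
          finite_subset mem_Collect_eq subsetI)
    then have "x p + x q = (\<Sum>j\<in>{p, q}. x j)" by simp
    also have "\<dots> \<le> (\<Sum>j<n. x j)"
      using pq x0 by (intro sum_mono2) (auto simp: H_def I_def)
    finally show False using pq x1 by (simp add: H_def)
  qed
  moreover have "card (fst ` E \<union> snd ` E) \<le> card E + card E"
    using finE by (meson add_mono card_Un_le card_image_le order_trans)
  moreover have "card I \<le> card G + card H + card (fst ` E \<union> snd ` E)"
  proof -
    have "I \<subseteq> G \<union> H \<union> (fst ` E \<union> snd ` E)" by (auto simp: G_def)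
    moreover have "finite (G \<union> H \<union> (fst ` E \<union> snd ` E))"
      using finI finE by (simp add: G_def H_def)
    ultimately have "card I \<le> card (G \<union> H \<union> (fst ` E \<union> snd ` E))" by (rule card_mono[rotated])
    then show ?thesis by (meson card_Un_le add_mono order_trans le_refl)
  qed
  moreover have "k + 1 \<le> card I" using supp by (simp add: support_size_def I_def)
  moreover have "real (card E) < k / 4" using few by (simp add: E_def)
  ultimately have G: "real (card G) > k / 2" by linarith
  have finG: "finite G" using finI by (simp add: G_def)
  have mass: "r \<le> (\<Sum>j<n. if j \<noteq> i \<and> Q i j \<le> - w then x j else 0)" if "i \<in> G" for i
  proof -
    have i: "i < n" "x i > 0" "x i \<le> 1 / 2" using that by (auto simp: G_def H_def I_def)
    have "- B < Q i j" if j: "j < n" "j \<noteq> i" for j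
    proof (rule ccontr)
      assume "\<not> - B < Q i j"
      with j i have "(i, j) \<in> E \<or> (j, i) \<in> E" using sym[of i j] by (auto simp: E_def)
      with \<open>i \<in> G\<close> show False by (force simp: G_def)
    qed
    then have "r \<le> (\<Sum>j \<in> {j \<in> {..<n}. j \<noteq> i \<and> Q i j \<le> - w}. x j)"
      unfolding r_def
      by (rule row_mass_of_negative_entries[where Q = Q, OF x i(1,3) minimizer_row_le[where Q = Q, OF min sym i(1,2)]
            minimizer_le_diag[where Q = Q, OF min sym i(1)]
            order_trans[OF minimizer_le_diag[where Q = Q, OF min sym l(1)] l(2)] wv vB])
    also have "\<dots> = (\<Sum>j<n. if j \<noteq> i \<and> Q i j \<le> - w then x j else 0)"
      using sum.inter_filter[of "{..<n}" x "\<lambda>j. j \<noteq> i \<and> Q i j \<le> - w"] by simp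
    finally show ?thesis .
  qed
  have "r * card G \<le> (\<Sum>i\<in>G. \<Sum>j<n. if j \<noteq> i \<and> Q i j \<le> - w then x j else 0)"
    using sum_mono[OF mass, of G "\<lambda>i. i"] by (simp add: mult.commute)
  also have "\<dots> = (\<Sum>j<n. \<Sum>i\<in>G. if j \<noteq> i \<and> Q i j \<le> - w then x j else 0)"
    by (rule sum.swap)
  also have "\<dots> \<le> (\<Sum>j<n. x j * (r * (k / 2)))"
  proof (rule sum_mono)
    fix j assume j: "j \<in> {..<n}"
    have "(\<Sum>i\<in>G. if j \<noteq> i \<and> Q i j \<le> - w then x j else 0) =
        x j * card {i \<in> G. j \<noteq> i \<and> Q i j \<le> - w}"
      using finG by (simp add: sum.inter_filter[symmetric] mult.commute)
    also have "\<dots> \<le> x j * c j"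
      using j x0[of j] unfolding c_def
      by (intro mult_left_mono of_nat_mono card_mono) (auto simp: G_def I_def)
    also have "\<dots> \<le> x j * (r * (k / 2))"
      using j x0[of j] small[of j] by (intro mult_left_mono) auto
    finally show "(\<Sum>i\<in>G. if j \<noteq> i \<and> Q i j \<le> - w then x j else 0) \<le> x j * (r * (k / 2))" .
  qed
  also have "\<dots> = r * (k / 2)" by (simp only: sum_distrib_right[symmetric] x1 mult_1)
  finally show False using G r by simp
qed

section \<open>Many rare independent events\<close>

lemma (in prob_space) prob_many_indep_events_le:
  assumes ind: "indep_events A J" and fin: "finite J"
    and p: "\<And>i. i \<in> J \<Longrightarrow> prob (A i) \<le> p" and p0: "0 \<le> p"
  shows "{\<omega> \<in> space M. m \<le> card {i \<in> J. \<omega> \<in> A i}} \<in> events"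
    and "prob {\<omega> \<in> space M. m \<le> card {i \<in> J. \<omega> \<in> A i}} \<le> real (card J choose m) * p ^ m"
proof -
  have ev: "A i \<in> events" if "i \<in> J" for i
    using ind that by (auto simp: indep_events_def)
  define B where "B T = {\<omega> \<in> space M. \<forall>i\<in>T. \<omega> \<in> A i}" for T
  define TT where "TT = {T. T \<subseteq> J \<and> card T = m}"
  have finT: "finite TT" using fin by (simp add: TT_def)
  have Bev: "B T \<in> events" if "T \<subseteq> J" for T
  proof -
    have "finite T" using that fin by (rule finite_subset)
    moreover have "{\<omega> \<in> space M. \<omega> \<in> A i} \<in> events" if "i \<in> T" for i
    proof -
      have "i \<in> J" using that \<open>T \<subseteq> J\<close> by auto
      then show ?thesis by (simp add: Collect_conj_eq ev sets.Int)
    qed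
    ultimately show ?thesis unfolding B_def
      by (intro sets.sets_Collect_finite_All)
  qed
  have eq: "{\<omega> \<in> space M. m \<le> card {i \<in> J. \<omega> \<in> A i}} = (\<Union>T\<in>TT. B T)"
  proof (intro set_eqI iffI)
    fix \<omega> assume w: "\<omega> \<in> {\<omega> \<in> space M. m \<le> card {i \<in> J. \<omega> \<in> A i}}"
    then obtain T where "T \<subseteq> {i \<in> J. \<omega> \<in> A i}" "card T = m"
      by (auto elim: obtain_subset_with_card_n)
    with w show "\<omega> \<in> (\<Union>T\<in>TT. B T)" by (auto simp: TT_def B_def)
  next
    fix \<omega> assume "\<omega> \<in> (\<Union>T\<in>TT. B T)"
    then obtain T where T: "T \<subseteq> J" "card T = m" "\<omega> \<in> B T" by (auto simp: TT_def)
    then have "T \<subseteq> {i \<in> J. \<omega> \<in> A i}" by (auto simp: B_def)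
    then have "card T \<le> card {i \<in> J. \<omega> \<in> A i}" using fin by (intro card_mono) auto
    with T show "\<omega> \<in> {\<omega> \<in> space M. m \<le> card {i \<in> J. \<omega> \<in> A i}}" by (auto simp: B_def)
  qed
  show "{\<omega> \<in> space M. m \<le> card {i \<in> J. \<omega> \<in> A i}} \<in> events"
    unfolding eq using finT Bev by (intro sets.finite_UN) (auto simp: TT_def)
  have "prob (B T) \<le> p ^ m" if T: "T \<in> TT" for T
  proof (cases "T = {}")
    case True
    then show ?thesis using T by (auto simp: TT_def)
  next
    case False
    have TJ: "T \<subseteq> J" "card T = m" "finite T" using T fin by (auto simp: TT_def intro: finite_subset)
    have "B T = (\<Inter>i\<in>T. A i)"
      using False TJ(1) ev[THEN sets.sets_into_space] by (auto simp: B_def)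
    then have "prob (B T) = (\<Prod>i\<in>T. prob (A i))"
      using ind TJ False by (simp add: indep_events_def)
    also have "\<dots> \<le> (\<Prod>i\<in>T. p)"
      using TJ p by (intro prod_mono) auto
    finally show ?thesis by (simp add: TJ)
  qed
  then have "(\<Sum>T\<in>TT. prob (B T)) \<le> (\<Sum>T\<in>TT. p ^ m)" by (rule sum_mono)
  also have "\<dots> = real (card J choose m) * p ^ m"
    using n_subsets[OF fin, of m] by (simp add: TT_def)
  finally show "prob {\<omega> \<in> space M. m \<le> card {i \<in> J. \<omega> \<in> A i}} \<le> real (card J choose m) * p ^ m"
    unfolding eq
    using finite_measure_subadditive_finite[OF finT, of B] Bev by (force simp: TT_def)
qed

text \<open>
  Choosing at most one of \<open>(i, j)\<close> and \<open>(j, i)\<close> makes the averages depend on disjoint sets of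
  matrix entries.
\<close>

lemma (in prob_space) indep_events_pairs:
  fixes X :: "nat \<times> nat \<Rightarrow> 'a \<Rightarrow> real"
  assumes ind: "indep_vars (\<lambda>_. borel) X I" and LI: "\<And>i j. (i, j) \<in> L \<Longrightarrow> (i, j) \<in> I \<and> (j, i) \<in> I"
    and L: "\<And>i j. (i, j) \<in> L \<Longrightarrow> (j, i) \<notin> L"
  shows "indep_events (\<lambda>(i, j). {\<omega> \<in> space M. (X (i, j) \<omega> + X (j, i) \<omega>) / 2 \<le> x}) L"
proof -
  define K where "K p = {p, (snd p, fst p)}" for p :: "nat \<times> nat"
  have "indep_vars (\<lambda>p. Pi\<^sub>M (K p) (\<lambda>_. borel)) (\<lambda>p \<omega>. restrict (\<lambda>i. X i \<omega>) (K p)) L"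
  proof (rule indep_vars_restrict[OF ind])
    show "K p \<subseteq> I" if "p \<in> L" for p using LI[of "fst p" "snd p"] that by (auto simp: K_def)
    show "disjoint_family_on K L"
      using L by (auto simp: disjoint_family_on_def K_def)
  qed
  then have "indep_vars (\<lambda>_. borel)
      (\<lambda>p \<omega>. (\<lambda>f. (f p + f (snd p, fst p)) / 2) (restrict (\<lambda>i. X i \<omega>) (K p))) L"
    by (rule indep_vars_compose2) (auto simp: K_def)
  then have "indep_events (\<lambda>p. {\<omega> \<in> space M.
      (\<lambda>f. (f p + f (snd p, fst p)) / 2) (restrict (\<lambda>i. X i \<omega>) (K p)) \<le> x}) L"
    by (rule indep_eventsI_indep_vars) auto
  then show ?thesis
    by (simp add: K_def case_prod_beta')
qed

section \<open>The tail of an average of two entries\<close>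

lemma powr_midpoint_le:
  fixes x y1 y2 b :: real
  assumes b: "b > 1" and x: "0 \<le> x" and y: "y1 + y2 \<le> - 2 * x"
  shows "2 * x powr b \<le> (max 0 (- y1)) powr b + (max 0 (- y2)) powr b"
proof -
  define u w where "u = max 0 (- y1)" and "w = max 0 (- y2)"
  have uw: "0 \<le> u" "0 \<le> w" "2 * x \<le> u + w" using y by (auto simp: u_def w_def)
  have both: "2 * x powr b \<le> u powr b + w powr b" if "0 < u" "0 < w"
  proof -
    have "2 * x powr b \<le> 2 * ((1 - 1/2) *\<^sub>R u + (1/2) *\<^sub>R w) powr b"
      using uw x b by (intro mult_left_mono powr_mono2) auto
    also have "\<dots> \<le> 2 * ((1 - 1/2) * u powr b + (1/2) * w powr b)"
      using that b by (intro mult_left_mono convex_onD[OF powr_convex]) auto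
    finally show ?thesis by simp
  qed
  \<comment> \<open>When one of the two parts vanishes, the other is at least \<open>2 x\<close>, and \<open>2 powr b \<ge> 2\<close>.\<close>
  have one: "2 * x powr b \<le> z powr b" if "2 * x \<le> z" for z
  proof -
    have "2 powr 1 * x powr b \<le> 2 powr b * x powr b"
      using b by (intro mult_right_mono powr_mono) auto
    also have "\<dots> = (2 * x) powr b" using x by (simp add: powr_mult)
    also have "\<dots> \<le> z powr b" using that x b by (intro powr_mono2) auto
    finally show ?thesis by simp
  qed
  have "2 * x powr b \<le> u powr b + w powr b"
  proof (cases "0 < u \<and> 0 < w")
    case False
    then have "2 * x \<le> u \<or> 2 * x \<le> w" using uw by linarith
    then show ?thesis using one[of u] one[of w] powr_ge_zero[of u b] powr_ge_zero[of w b] by linarith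
  qed (use both in blast)
  then show ?thesis by (simp add: u_def w_def)
qed

text \<open>
  If the sum reaches \<open>Z\<close>, then for \<open>l\<close> the integer part of the first summand the second one
  is at least \<open>Z - l - 1\<close>; each \<open>l\<close> costs the same by independence. The number of levels, which
  is linear in \<open>Z\<close>, is absorbed by lowering the rate from \<open>7/8\<close> to \<open>3/4\<close>.
\<close>

lemma (in prob_space) prob_sum_exp_tails:
  assumes ind: "indep_var borel U borel W"
    and U: "\<And>z. prob {\<omega> \<in> space M. z \<le> U \<omega>} \<le> C * exp (- (7/8) * z)"
    and W: "\<And>z. prob {\<omega> \<in> space M. z \<le> W \<omega>} \<le> C * exp (- (7/8) * z)"
    and U0: "\<And>\<omega>. 0 \<le> U \<omega>" and W0: "\<And>\<omega>. 0 \<le> W \<omega>" and Z: "0 \<le> Z"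
  shows "prob {\<omega> \<in> space M. Z \<le> U \<omega> + W \<omega>} \<le> 32 * C\<^sup>2 * exp (- (3/4) * Z)"
proof -
  have [measurable]: "U \<in> borel_measurable M" "W \<in> borel_measurable M"
    using indep_var_rv1[OF ind] indep_var_rv2[OF ind] by auto
  define N where "N = nat \<lfloor>Z\<rfloor>"
  define B where "B l = {\<omega> \<in> space M. real l \<le> U \<omega>} \<inter> {\<omega> \<in> space M. Z - real l - 1 \<le> W \<omega>}" for l
  have NZ: "real N \<le> Z" "Z < real N + 1" using Z unfolding N_def by linarith+
  have C0: "0 \<le> C"
    using order_trans[OF measure_nonneg U[of 0]] by simp
  have Bl: "prob (B l) \<le> C\<^sup>2 * exp (7/8) * exp (- (7/8) * Z)" for l
  proof -
    have "prob (B l) = prob {\<omega> \<in> space M. real l \<le> U \<omega>} * prob {\<omega> \<in> space M. Z - real l - 1 \<le> W \<omega>}"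
    proof -
      have "B l = (\<lambda>\<omega>. (U \<omega>, W \<omega>)) -` ({real l..} \<times> {Z - real l - 1..}) \<inter> space M"
        by (auto simp: B_def)
      then show ?thesis
        using indep_varD[OF ind, of "{real l..}" "{Z - real l - 1..}"]
        by (simp add: vimage_def Int_def conj_commute)
    qed
    also have "\<dots> \<le> (C * exp (- (7/8) * real l)) * (C * exp (- (7/8) * (Z - real l - 1)))"
      using C0 by (intro mult_mono U W) auto
    also have "\<dots> = C\<^sup>2 * exp (7/8) * exp (- (7/8) * Z)"
      by (simp add: power2_eq_square mult_exp_exp) (simp add: field_simps)
    finally show ?thesis .
  qed
  have "{\<omega> \<in> space M. Z \<le> U \<omega> + W \<omega>} \<subseteq> (\<Union>l\<in>{..N}. B l)"
  proof
    fix \<omega> assume w: "\<omega> \<in> {\<omega> \<in> space M. Z \<le> U \<omega> + W \<omega>}"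
    \<comment> \<open>The level is capped at \<open>N\<close>; there the condition on \<open>W\<close> asks for a negative number.\<close>
    define l where "l = min N (nat \<lfloor>U \<omega>\<rfloor>)"
    have "real l \<le> U \<omega>" using U0[of \<omega>] by (simp add: l_def min_def) linarith
    moreover have "Z - real l - 1 \<le> W \<omega>"
    proof (cases "N \<le> nat \<lfloor>U \<omega>\<rfloor>")
      case True
      then show ?thesis using NZ W0[of \<omega>] by (simp add: l_def)
    next
      case False
      then have "U \<omega> < real l + 1" using U0[of \<omega>] by (simp add: l_def)
      then show ?thesis using w by simp
    qed
    ultimately have "\<omega> \<in> B l" using w by (simp add: B_def)
    then show "\<omega> \<in> (\<Union>l\<in>{..N}. B l)" by (auto simp: l_def)
  qed
  then have "prob {\<omega> \<in> space M. Z \<le> U \<omega> + W \<omega>} \<le> prob (\<Union>l\<in>{..N}. B l)"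
    by (intro finite_measure_mono) (auto simp: B_def)
  also have "\<dots> \<le> (\<Sum>l\<in>{..N}. prob (B l))"
    by (intro finite_measure_subadditive_finite) (auto simp: B_def)
  also have "\<dots> \<le> (\<Sum>l\<in>{..N}. C\<^sup>2 * exp (7/8) * exp (- (7/8) * Z))"
    by (intro sum_mono Bl)
  also have "\<dots> = (real N + 1) * (C\<^sup>2 * exp (7/8) * exp (- (7/8) * Z))" by simp
  also have "\<dots> \<le> (8 * exp (Z / 8)) * (C\<^sup>2 * 4 * exp (- (7/8) * Z))"
  proof (intro mult_mono mult_right_mono mult_left_mono)
    have "1 + Z / 8 \<le> exp (Z / 8)" by (rule exp_ge_add_one_self)
    then show "real N + 1 \<le> 8 * exp (Z / 8)" using NZ by linarith
    have "exp (7/8) \<le> exp (1::real)" by simp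
    also have "\<dots> \<le> 4" using exp_le by linarith
    finally show "exp (7/8) \<le> (4::real)" .
  qed auto
  also have "\<dots> = 32 * C\<^sup>2 * (exp (Z / 8) * exp (- (7/8) * Z))" by simp
  also have "exp (Z / 8) * exp (- (7/8) * Z) = exp (- (3/4) * Z)"
    by (simp add: mult_exp_exp)
  finally show ?thesis .
qed

text \<open>
  The transform \<open>y \<mapsto> (max 0 (- y)) powr b\<close> turns the lower tails of the entries into
  exponential tails, and by convexity an average at most \<open>- x\<close> makes the two transforms add up to
  at least \<open>2 (x powr b)\<close>. A rate above 1 is what makes a column of \<open>n\<close> off-diagonal entries
  contain fewer entries near the smallest of \<open>n\<close> diagonal entries than a large support requires.
\<close>

lemma (in prob_space) prob_average_tail:
  fixes X :: "nat \<times> nat \<Rightarrow> 'a \<Rightarrow> real"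
  assumes ind: "indep_vars (\<lambda>_. borel) X I" and pq: "p \<in> I" "q \<in> I" "p \<noteq> q"
    and cdf: "\<And>r y. r \<in> I \<Longrightarrow> prob {\<omega> \<in> space M. X r \<omega> \<le> y} = G y"
    and G: "\<And>y. 0 \<le> y \<Longrightarrow> G (- y) \<le> C * exp (- (7/8) * y powr b)" and C: "1 \<le> C"
    and b: "b > 1" and x: "0 \<le> x"
  shows "prob {\<omega> \<in> space M. (X p \<omega> + X q \<omega>) / 2 \<le> - x} \<le> 32 * C\<^sup>2 * exp (- (3/2) * x powr b)"
proof -
  define F where "F y = max 0 (- y) powr b" for y :: real
  have [measurable]: "F \<in> borel_measurable borel" by (simp add: F_def[abs_def])
  have [measurable]: "X p \<in> borel_measurable M" "X q \<in> borel_measurable M"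
    using ind pq by (auto simp: indep_vars_def)
  have "indep_var borel ((\<lambda>f. f p) \<circ> (\<lambda>\<omega>. restrict (\<lambda>i. X i \<omega>) {p}))
      borel ((\<lambda>f. f q) \<circ> (\<lambda>\<omega>. restrict (\<lambda>i. X i \<omega>) {q}))"
    using pq by (intro indep_var_compose[OF indep_var_restrict[OF ind]]) auto
  then have "indep_var borel (X p) borel (X q)" by (simp add: comp_def)
  then have indF: "indep_var borel (\<lambda>\<omega>. F (X p \<omega>)) borel (\<lambda>\<omega>. F (X q \<omega>))"
    using indep_var_compose[of borel "X p" borel "X q" F borel F borel] by (simp add: comp_def)
  have tail: "prob {\<omega> \<in> space M. z \<le> F (X r \<omega>)} \<le> C * exp (- (7/8) * z)" if r: "r \<in> I" for r z
  proof (cases "z \<le> 0")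
    case True
    have "prob {\<omega> \<in> space M. z \<le> F (X r \<omega>)} \<le> 1 * 1" by simp
    also have "\<dots> \<le> C * exp (- (7/8) * z)" using C True by (intro mult_mono) auto
    finally show ?thesis .
  next
    case False
    then have z: "z > 0" by simp
    have "{\<omega> \<in> space M. z \<le> F (X r \<omega>)} = {\<omega> \<in> space M. X r \<omega> \<le> - (z powr (1 / b))}"
    proof -
      have "z \<le> F y \<longleftrightarrow> y \<le> - (z powr (1 / b))" for y
      proof
        assume "z \<le> F y"
        then have "z powr (1 / b) \<le> F y powr (1 / b)" using z b by (intro powr_mono2) auto
        also have "\<dots> = max 0 (- y)" using b by (simp add: F_def powr_powr)
        finally show "y \<le> - (z powr (1 / b))"
          using z by (cases "y \<le> 0") (auto simp: max_def not_le split: if_splits)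
      next
        assume y: "y \<le> - (z powr (1 / b))"
        then have "z powr (1 / b) \<le> max 0 (- y)" by auto
        then have "(z powr (1 / b)) powr b \<le> F y" unfolding F_def using b by (intro powr_mono2) auto
        then show "z \<le> F y" using z b by (simp add: powr_powr)
      qed
      then show ?thesis by simp
    qed
    then have "prob {\<omega> \<in> space M. z \<le> F (X r \<omega>)} = G (- (z powr (1 / b)))" using r by (simp add: cdf)
    also have "\<dots> \<le> C * exp (- (7/8) * (z powr (1 / b)) powr b)" by (intro G) auto
    also have "(z powr (1 / b)) powr b = z" using z b by (simp add: powr_powr)
    finally show ?thesis .
  qed
  have "prob {\<omega> \<in> space M. (X p \<omega> + X q \<omega>) / 2 \<le> - x} \<le>
      prob {\<omega> \<in> space M. 2 * x powr b \<le> F (X p \<omega>) + F (X q \<omega>)}"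
    using powr_midpoint_le[OF b x] by (intro finite_measure_mono) (auto simp: F_def)
  also have "\<dots> \<le> 32 * C\<^sup>2 * exp (- (3/4) * (2 * x powr b))"
    using tail pq by (intro prob_sum_exp_tails[OF indF]) (auto simp: F_def)
  finally show ?thesis by simp
qed

section \<open>Probabilities of the exceptional events\<close>

text \<open>
  The gain over \<open>n ^ m * p ^ m\<close> comes from \<open>m! \<ge> (m / e) ^ m\<close>; it is essential for \<open>k\<close> of
  order \<open>sqrt n\<close>.
\<close>

lemma binomial_times_power_le:
  assumes p: "0 \<le> p" and m: "1 \<le> m"
  shows "real (n choose m) * p ^ m \<le> (exp 1 * n * p / m) ^ m"
proof -
  have "real m ^ m / fact m \<le> (\<Sum>j\<le>m. real m ^ j / fact j)"
    by (rule member_le_sum) auto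
  also have "\<dots> \<le> exp (real m)"
    using sum_le_suminf[OF summable_exp_generic[of "real m"], of "{..m}"]
    by (simp add: exp_def divide_inverse mult.commute)
  finally have "real m ^ m \<le> exp 1 ^ m * fact m"
    by (simp add: exp_of_nat_mult[symmetric] divide_le_eq)
  then have "real (n choose m) * real m ^ m \<le> exp 1 ^ m * (real (n choose m) * fact m)"
    by (metis mult.left_commute mult_left_mono of_nat_0_le_iff)
  also have "\<dots> \<le> exp 1 ^ m * real n ^ m"
    using binomial_fact_pow[of n m]
    by (intro mult_left_mono) (metis of_nat_fact of_nat_le_iff of_nat_mult of_nat_power, simp)
  finally have "real (n choose m) \<le> (exp 1 * n / m) ^ m"
    using m by (simp add: power_divide power_mult_distrib le_divide_eq)
  then have "real (n choose m) * p ^ m \<le> (exp 1 * n / m) ^ m * p ^ m"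
    using p by (intro mult_right_mono) auto
  then show ?thesis by (simp add: power_mult_distrib[symmetric])
qed

lemma (in prob_space) prob_no_small_diag:
  fixes X :: "nat \<times> nat \<Rightarrow> 'a \<Rightarrow> real" and G :: "real \<Rightarrow> real"
  assumes ind: "indep_vars (\<lambda>_. borel) X ({..<n} \<times> {..<n})"
    and cdf: "\<And>r y. r \<in> {..<n} \<times> {..<n} \<Longrightarrow> prob {\<omega> \<in> space M. X r \<omega> \<le> y} = G y"
    and n: "n \<ge> 1"
  shows "{\<omega> \<in> space M. \<forall>l<n. y < X (l, l) \<omega>} \<in> events"
    and "prob {\<omega> \<in> space M. \<forall>l<n. y < X (l, l) \<omega>} \<le> exp (- real n * G y)"
proof -
  let ?J = "(\<lambda>l. (l, l)) ` {..<n}"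
  have X: "X r \<in> borel_measurable M" if "r \<in> {..<n} \<times> {..<n}" for r
    using ind that by (auto simp: indep_vars_def)
  have ne: "{..<n} \<noteq> {}" using n by (metis lessThan_iff empty_iff less_eq_Suc_le One_nat_def)
  then have eq: "{\<omega> \<in> space M. \<forall>l<n. y < X (l, l) \<omega>} = (\<Inter>r\<in>?J. X r -` {y<..} \<inter> space M)"
    by auto
  show "{\<omega> \<in> space M. \<forall>l<n. y < X (l, l) \<omega>} \<in> events"
    unfolding eq using ne X by (intro sets.finite_INT) (auto intro!: measurable_sets)
  have one: "prob (X r -` {y<..} \<inter> space M) = 1 - G y" if r: "r \<in> ?J" for r
  proof -
    have [measurable]: "X r \<in> borel_measurable M" using r X by auto
    have "X r -` {y<..} \<inter> space M = space M - {\<omega> \<in> space M. X r \<omega> \<le> y}" by auto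
    then show ?thesis using r prob_compl[of "{\<omega> \<in> space M. X r \<omega> \<le> y}"] cdf[of r y] by auto
  qed
  have "0 \<le> 1 - G y" using one[of "(0, 0)"] n by (metis (no_types, lifting) image_eqI lessThan_iff
        less_eq_Suc_le One_nat_def measure_nonneg)
  have "prob (\<Inter>r\<in>?J. X r -` {y<..} \<inter> space M) = (\<Prod>r\<in>?J. prob (X r -` {y<..} \<inter> space M))"
    using ne by (intro indep_varsD[OF ind]) auto
  also have "\<dots> = (1 - G y) ^ card ?J" by (simp add: one)
  also have "card ?J = n" by (subst card_image) (auto simp: inj_on_def)
  also have "(1 - G y) ^ n \<le> exp (- G y) ^ n"
    using \<open>0 \<le> 1 - G y\<close> exp_ge_add_one_self[of "- G y"] by (intro power_mono) auto
  also have "\<dots> = exp (- real n * G y)" by (simp add: exp_of_nat_mult[symmetric])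
  finally show "prob {\<omega> \<in> space M. \<forall>l<n. y < X (l, l) \<omega>} \<le> exp (- real n * G y)" unfolding eq .
qed

lemma (in prob_space) prob_many_small_pairs:
  fixes X :: "nat \<times> nat \<Rightarrow> 'a \<Rightarrow> real" and k p y :: real
  assumes ind: "indep_vars (\<lambda>_. borel) X ({..<n} \<times> {..<n})"
    and p: "\<And>i j. i < n \<Longrightarrow> j < n \<Longrightarrow> i \<noteq> j \<Longrightarrow>
      prob {\<omega> \<in> space M. (X (i, j) \<omega> + X (j, i) \<omega>) / 2 \<le> y} \<le> p" and p0: "0 \<le> p"
    and small: "real n ^ 2 * p \<le> exp (- 4)" and k: "k / 4 \<le> real m"
  defines "S \<equiv> {\<omega> \<in> space M. m \<le> card {q \<in> {(i, j). i < j \<and> j < n}. (X q \<omega> + X (snd q, fst q) \<omega>) / 2 \<le> y}}"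
  shows "S \<in> events" and "prob S \<le> exp (- k)"
proof -
  let ?L = "{(i, j). i < j \<and> j < n}"
  let ?A = "\<lambda>(i, j). {\<omega> \<in> space M. (X (i, j) \<omega> + X (j, i) \<omega>) / 2 \<le> y}"
  have sub: "?L \<subseteq> {..<n} \<times> {..<n}" by auto
  then have fin: "finite ?L" by (rule finite_subset) simp
  have indA: "indep_events ?A ?L"
    by (rule indep_events_pairs[OF ind]) auto
  have S: "S = {\<omega> \<in> space M. m \<le> card {q \<in> ?L. \<omega> \<in> ?A q}}"
    unfolding S_def by (intro Collect_cong conj_cong refl arg_cong[where f = "\<lambda>T. m \<le> card T"]) auto
  have pA: "prob (?A q) \<le> p" if "q \<in> ?L" for q using that p by auto
  show "S \<in> events" unfolding S by (rule prob_many_indep_events_le[OF indA fin pA p0])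
  have "prob S \<le> real (card ?L choose m) * p ^ m"
    unfolding S by (rule prob_many_indep_events_le[OF indA fin pA p0])
  also have "real (card ?L choose m) \<le> (real n ^ 2) ^ m"
  proof -
    have "card ?L \<le> n ^ 2" using card_mono[OF _ sub] by (simp add: power2_eq_square)
    moreover have "card ?L choose m \<le> card ?L ^ m"
      using binomial_fact_pow[of "card ?L" m] fact_ge_1[of m, where 'a = nat]
      by (metis (no_types) mult.commute le_trans mult_le_mono1 nat_mult_1)
    ultimately have "card ?L choose m \<le> (n ^ 2) ^ m"
      by (meson order_trans power_mono zero_le)
    then show ?thesis by (metis of_nat_le_iff of_nat_power)
  qed
  also have "(real n ^ 2) ^ m * p ^ m = (real n ^ 2 * p) ^ m" by (simp add: power_mult_distrib)
  also have "\<dots> \<le> exp (- 4) ^ m" using small p0 by (intro power_mono) auto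
  also have "\<dots> = exp (- 4 * real m)" by (simp add: exp_of_nat_mult[symmetric] mult.commute)
  also have "\<dots> \<le> exp (- k)" using k by simp
  finally show "prob S \<le> exp (- k)" using p0 by (simp add: mult_right_mono)
qed

text \<open>
  The column \<open>j\<close> consists of independent entries. The smallness condition makes each of the at
  least \<open>r k\<close> rare entries cost a factor \<open>exp (- 1 / r)\<close>.
\<close>

lemma (in prob_space) prob_dense_column:
  fixes X :: "nat \<times> nat \<Rightarrow> 'a \<Rightarrow> real" and r p y :: real and k :: nat
  assumes ind: "indep_vars (\<lambda>_. borel) X ({..<n} \<times> {..<n})"
    and p: "\<And>i j. i < n \<Longrightarrow> j < n \<Longrightarrow> i \<noteq> j \<Longrightarrow>
      prob {\<omega> \<in> space M. (X (i, j) \<omega> + X (j, i) \<omega>) / 2 \<le> y} \<le> p" and p0: "0 \<le> p"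
    and r: "r > 0" and k: "k > 0" and small: "exp 1 * n * p / (r * k) \<le> exp (- (1 / r))"
    and j: "j < n"
  defines "S \<equiv> {\<omega> \<in> space M. r * k \<le> card {i \<in> {i. i < n \<and> i \<noteq> j}. (X (i, j) \<omega> + X (j, i) \<omega>) / 2 \<le> y}}"
  shows "S \<in> events" and "prob S \<le> exp (- real k)"
proof -
  define m where "m = nat \<lceil>r * k\<rceil>"
  have m: "r * k \<le> real m" "1 \<le> m" using r k by (auto simp: m_def Suc_le_eq)
  let ?L = "(\<lambda>i. (i, j)) ` {i. i < n \<and> i \<noteq> j}"
  let ?A = "\<lambda>(i, j). {\<omega> \<in> space M. (X (i, j) \<omega> + X (j, i) \<omega>) / 2 \<le> y}"
  have indA: "indep_events ?A ?L"
    using j by (intro indep_events_pairs[OF ind]) auto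
  have fin: "finite ?L" by simp
  have inj: "inj_on (\<lambda>i. (i, j)) T" for T by (simp add: inj_on_def)
  have "card {q \<in> ?L. \<omega> \<in> ?A q} = card {i \<in> {i. i < n \<and> i \<noteq> j}. (X (i, j) \<omega> + X (j, i) \<omega>) / 2 \<le> y}"
    if "\<omega> \<in> space M" for \<omega>
  proof -
    have "{q \<in> ?L. \<omega> \<in> ?A q} = (\<lambda>i. (i, j)) ` {i \<in> {i. i < n \<and> i \<noteq> j}. (X (i, j) \<omega> + X (j, i) \<omega>) / 2 \<le> y}"
      using that by auto
    then show ?thesis by (simp add: card_image inj)
  qed
  moreover have "r * k \<le> real c \<longleftrightarrow> m \<le> c" for c
    using r k by (simp add: m_def nat_le_iff ceiling_le_iff)
  ultimately have S: "S = {\<omega> \<in> space M. m \<le> card {q \<in> ?L. \<omega> \<in> ?A q}}"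
    unfolding S_def by auto
  have pA: "prob (?A q) \<le> p" if "q \<in> ?L" for q using that p j by auto
  show "S \<in> events" unfolding S by (rule prob_many_indep_events_le[OF indA fin pA p0])
  have "card ?L \<le> n"
    using card_mono[of "{..<n}" "{i. i < n \<and> i \<noteq> j}"] by (auto simp: card_image inj)
  have "prob S \<le> real (card ?L choose m) * p ^ m"
    unfolding S by (rule prob_many_indep_events_le[OF indA fin pA p0])
  also have "\<dots> \<le> real (n choose m) * p ^ m"
    using \<open>card ?L \<le> n\<close> p0 by (intro mult_right_mono of_nat_mono binomial_right_mono) auto
  also have "\<dots> \<le> (exp 1 * n * p / m) ^ m" by (rule binomial_times_power_le[OF p0 m(2)])
  also have "\<dots> \<le> exp (- (1 / r)) ^ m"
  proof (rule power_mono)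
    have "exp 1 * n * p / m \<le> exp 1 * n * p / (r * k)"
      using m r k p0 by (intro divide_left_mono) auto
    then show "exp 1 * n * p / m \<le> exp (- (1 / r))" using small by linarith
  qed (use p0 in auto)
  also have "\<dots> = exp (- (real m / r))" by (simp add: exp_of_nat_mult[symmetric])
  also have "\<dots> \<le> exp (- real k)" using m(1) r by (simp add: le_divide_eq mult.commute)
  finally show "prob S \<le> exp (- real k)" .
qed

section \<open>Choice of the thresholds\<close>

text \<open>
  The polynomial factor and the constant in the tail are absorbed by changing the rate slightly;
  the rates \<open>5/4\<close> and \<open>7/8\<close> leave enough room for the choices in \<open>eventually_thresholds\<close>.
\<close>

lemma left_tail_bounds:
  assumes tail: "left_tail G c \<kappa> a b" and c: "c > 0" and kap: "\<kappa> > 0" and b: "b > 1"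
  shows "\<exists>y0>0. \<forall>y\<ge>y0. exp (- (5/4) * y powr b) \<le> G (- y) \<and> G (- y) \<le> exp (- (7/8) * y powr b)"
proof -
  obtain \<delta> where d: "\<delta> \<in> O[at_bot](\<lambda>x. \<bar>x\<bar> powr (- \<kappa>))"
    and G: "\<forall>\<^sub>F x in at_bot. G x = (c + \<delta> x) * \<bar>x\<bar> powr a * exp (- (\<bar>x\<bar> powr b))"
    using tail by (auto simp: left_tail_def)
  note d
  also have "(\<lambda>x::real. \<bar>x\<bar> powr (- \<kappa>)) \<in> o[at_bot](\<lambda>_. 1)"
    using kap by real_asymp
  finally have "(\<delta> \<longlongrightarrow> 0) at_bot" using smalloD_tendsto by fastforce
  then have "\<forall>\<^sub>F x in at_bot. \<bar>\<delta> x\<bar> < c / 2"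
    using c tendstoD[of \<delta> 0 at_bot "c / 2"] by (simp add: dist_real_def)
  with G have "\<forall>\<^sub>F x in at_bot. c / 2 * \<bar>x\<bar> powr a * exp (- (\<bar>x\<bar> powr b)) \<le> G x \<and>
      G x \<le> 2 * c * \<bar>x\<bar> powr a * exp (- (\<bar>x\<bar> powr b))"
  proof eventually_elim
    case (elim x)
    then have "c / 2 \<le> c + \<delta> x" "c + \<delta> x \<le> 2 * c" by linarith+
    then show ?case unfolding elim(1) by (intro conjI mult_right_mono) auto
  qed
  then have "\<forall>\<^sub>F y in at_top. c / 2 * \<bar>- y\<bar> powr a * exp (- (\<bar>- y\<bar> powr b)) \<le> G (- y) \<and>
      G (- y) \<le> 2 * c * \<bar>- y\<bar> powr a * exp (- (\<bar>- y\<bar> powr b))"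
    by (simp add: at_bot_mirror eventually_filtermap)
  moreover have "\<forall>\<^sub>F y::real in at_top. exp (- (1/4) * y) \<le> c / 2 * y powr a" using c by real_asymp
  moreover have "\<forall>\<^sub>F y::real in at_top. 2 * c * y powr a \<le> exp (1/8 * y)" using c by real_asymp
  moreover have "\<forall>\<^sub>F y::real in at_top. y \<ge> 1" by (rule eventually_ge_at_top)
  ultimately have "\<forall>\<^sub>F y in at_top. y \<ge> 1 \<and> exp (- (5/4) * y powr b) \<le> G (- y) \<and>
      G (- y) \<le> exp (- (7/8) * y powr b)"
  proof eventually_elim
    case (elim y)
    have yb: "y \<le> y powr b" using elim(4) b powr_mono[of 1 b y] by simp
    have "exp (- (5/4) * y powr b) = exp (- (1/4) * y powr b) * exp (- (y powr b))"
      by (simp add: mult_exp_exp)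
    also have "\<dots> \<le> exp (- (1/4) * y) * exp (- (y powr b))" using yb by simp
    also have "\<dots> \<le> c / 2 * y powr a * exp (- (y powr b))" using elim(2) by (intro mult_right_mono) auto
    also have "\<dots> \<le> G (- y)" using elim(1,4) by simp
    finally have lo: "exp (- (5/4) * y powr b) \<le> G (- y)" .
    have "G (- y) \<le> 2 * c * y powr a * exp (- (y powr b))" using elim(1,4) by simp
    also have "\<dots> \<le> exp (1/8 * y) * exp (- (y powr b))" using elim(3) by (intro mult_right_mono) auto
    also have "\<dots> \<le> exp (1/8 * y powr b) * exp (- (y powr b))" using yb by simp
    also have "\<dots> = exp (- (7/8) * y powr b)" by (simp add: mult_exp_exp)
    finally show ?case using lo elim(4) by simp
  qed
  then obtain y0 where "\<forall>y\<ge>y0. y \<ge> 1 \<and> exp (- (5/4) * y powr b) \<le> G (- y) \<and>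
      G (- y) \<le> exp (- (7/8) * y powr b)"
    by (auto simp: eventually_at_top_linorder)
  then show ?thesis by (intro exI[of _ "max y0 1"]) auto
qed

text \<open>
  With \<open>L = ln (n / k)\<close> the thresholds are chosen such that \<open>w powr b\<close>, \<open>v powr b\<close> and
  \<open>B powr b\<close> are \<open>3/4 L\<close>, \<open>4/5 L\<close> and \<open>4 L\<close>. Then \<open>n G(- v) \<ge> n exp (- L) = k\<close>; the
  condition on a column compares \<open>exp L\<close> with \<open>exp (- 9/8 L)\<close>; and the condition on pairs
  compares \<open>n\<^sup>2\<close> with \<open>exp (- 6 L)\<close>, where \<open>n\<^sup>2 = O(exp (4 L))\<close> because \<open>k\<close> is at most of
  order \<open>sqrt n\<close>. The ratio \<open>r\<close> does not depend on \<open>L\<close>, as all thresholds are multiples of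
  \<open>L powr (1/b)\<close>.
\<close>

lemma eventually_thresholds:
  fixes G :: "real \<Rightarrow> real" and y0 b C \<alpha> :: real
  assumes G: "\<forall>y\<ge>y0. exp (- (5/4) * y powr b) \<le> G (- y)" and b: "b > 1" and C: "1 \<le> C"
    and al: "\<alpha> > 0"
  shows "\<forall>\<^sub>F n in sequentially. \<forall>k. 1 \<le> k \<longrightarrow> k \<le> k_max \<alpha> n \<longrightarrow>
    (\<exists>w v B r :: real. 0 \<le> w \<and> w < v \<and> v < B \<and> r = (v - w) / (4 * (B - w)) \<and> k \<le> n * G (- v) \<and>
      real n ^ 2 * (32 * C\<^sup>2 * exp (- (3/2) * B powr b)) \<le> exp (- 4) \<and>
      exp 1 * n * (32 * C\<^sup>2 * exp (- (3/2) * w powr b)) / (r * k) \<le> exp (- (1 / r)))"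
proof -
  define u where "u t = (t::real) powr (1 / b)" for t
  define r where "r = (u (4/5) - u (3/4)) / (4 * (u 4 - u (3/4)))"
  have mono: "u s < u t" if "0 \<le> s" "s < t" for s t
    unfolding u_def using that b by (intro powr_less_mono2) auto
  have r0: "r > 0" using mono[of "3/4" "4/5"] mono[of "3/4" 4] by (simp add: r_def)
  define D where "D = \<alpha> + 1"
  have decay: "\<forall>\<^sub>F L::real in at_top. K * exp (- s * L) \<le> e" if "0 < s" "0 < e" for K s e :: real
  proof -
    have "((\<lambda>L. K * exp (- s * L)) \<longlongrightarrow> 0) at_top" using that(1) by real_asymp
    then have "\<forall>\<^sub>F L in at_top. K * exp (- s * L) < e" using that(2) by (rule order_tendstoD)
    then show ?thesis by eventually_elim simp
  qed
  have "\<forall>\<^sub>F L::real in at_top. 5/4 * max 0 y0 powr b \<le> L" by (rule eventually_ge_at_top)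
  then have "\<forall>\<^sub>F L::real in at_top. y0 \<le> (4/5 * L) powr (1 / b)"
  proof eventually_elim
    case (elim L)
    have "y0 \<le> (max 0 y0 powr b) powr (1 / b)" using b by (simp add: powr_powr)
    also have "\<dots> \<le> (4/5 * L) powr (1 / b)" using elim b by (intro powr_mono2) auto
    finally show ?case .
  qed
  moreover have "\<forall>\<^sub>F L::real in at_top. D ^ 4 * 32 * C\<^sup>2 * exp (- 2 * L) \<le> exp (- 4)"
    by (rule decay) auto
  moreover have "\<forall>\<^sub>F L::real in at_top. exp 1 * 32 * C\<^sup>2 / r * exp (- (1/8) * L) \<le> exp (- (1 / r))"
    by (rule decay) auto
  moreover have "\<forall>\<^sub>F L::real in at_top. 1 \<le> L" by (rule eventually_ge_at_top)
  ultimately have "\<forall>\<^sub>F L::real in at_top. y0 \<le> (4/5 * L) powr (1 / b) \<and>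
      D ^ 4 * 32 * C\<^sup>2 * exp (- 2 * L) \<le> exp (- 4) \<and>
      exp 1 * 32 * C\<^sup>2 / r * exp (- (1/8) * L) \<le> exp (- (1 / r)) \<and> 1 \<le> L"
    by eventually_elim blast
  then obtain L0 where L0: "\<And>L. L \<ge> L0 \<Longrightarrow> y0 \<le> u (4/5 * L) \<and>
      D ^ 4 * 32 * C\<^sup>2 * exp (- 2 * L) \<le> exp (- 4) \<and>
      exp 1 * 32 * C\<^sup>2 / r * exp (- (1/8) * L) \<le> exp (- (1 / r)) \<and> 1 \<le> L"
    by (auto simp: eventually_at_top_linorder u_def)
  have D0: "D > 0" using al by (simp add: D_def)
  then have "filterlim (\<lambda>n. sqrt (real n) / D) at_top sequentially"
    by real_asymp
  then have "\<forall>\<^sub>F n in sequentially. exp L0 \<le> sqrt (real n) / D"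
    by (simp add: filterlim_at_top)
  moreover have "\<forall>\<^sub>F n in sequentially. n \<ge> (1::nat)" by (rule eventually_ge_at_top)
  ultimately show ?thesis
  proof eventually_elim
    case (elim n)
    show ?case
    proof (intro allI impI)
      fix k assume k: "1 \<le> k" "k \<le> k_max \<alpha> n"
      define L where "L = ln (real n / real k)"
      have eL: "exp L = real n / real k" using k elim by (simp add: L_def)
      have "real k \<le> \<alpha> * sqrt n + 1"
      proof -
        have "real k \<le> real (nat \<lceil>\<alpha> * sqrt n\<rceil>)" using k by (simp add: k_max_def)
        also have "\<dots> \<le> \<alpha> * sqrt n + 1" using mult_nonneg_nonneg[of \<alpha> "sqrt n"] al by simp
        finally show ?thesis .
      qed
      also have "\<dots> \<le> D * sqrt n" using elim by (simp add: D_def algebra_simps)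
      finally have kD: "real k \<le> D * sqrt n" .
      have sq: "sqrt n * real k \<le> D * real n"
      proof -
        have "sqrt n * real k \<le> sqrt n * (D * sqrt n)" using kD by (intro mult_left_mono) auto
        then show ?thesis by (simp add: mult.left_commute)
      qed
      have sq': "sqrt n \<le> D * exp L" using k sq by (simp add: eL field_simps)
      have "D * exp L0 \<le> sqrt n" using elim D0 by (simp add: field_simps)
      with sq' have "D * exp L0 \<le> D * exp L" by linarith
      then have "exp L0 \<le> exp L" using D0 by simp
      then have "L0 \<le> L" by simp
      from L0[OF this] have y0: "y0 \<le> u (4/5 * L)"
        and one: "D ^ 4 * 32 * C\<^sup>2 * exp (- 2 * L) \<le> exp (- 4)"
        and two: "exp 1 * 32 * C\<^sup>2 / r * exp (- (1/8) * L) \<le> exp (- (1 / r))" and L: "1 \<le> L" by auto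
      have upow: "u t powr b = t" if "0 \<le> t" for t using that b by (simp add: u_def powr_powr)
      have uL: "u (t * L) = u t * u L" for t
        using L by (simp add: u_def powr_mult)
      have uL': "u (4/5 * L) = u (4/5) * u L" "u (3/4 * L) = u (3/4) * u L" "u (4 * L) = u 4 * u L"
        by (simp_all only: uL)
      have uL0: "u L > 0" using L by (simp add: u_def)
      have "0 \<le> u (3/4 * L)" by (simp add: u_def)
      moreover have "u (3/4 * L) < u (4/5 * L)" "u (4/5 * L) < u (4 * L)" using L by (auto intro!: mono)
      moreover have "r = (u (4/5 * L) - u (3/4 * L)) / (4 * (u (4 * L) - u (3/4 * L)))"
      proof -
        have "(u (4/5 * L) - u (3/4 * L)) / (4 * (u (4 * L) - u (3/4 * L))) =
            ((u (4/5) - u (3/4)) * u L) / ((4 * (u 4 - u (3/4))) * u L)"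
          unfolding uL' by (simp add: left_diff_distrib mult.assoc)
        then show ?thesis using uL0 by (simp add: r_def)
      qed
      moreover have "k \<le> n * G (- u (4/5 * L))"
      proof -
        have "real k = n * exp (- L)" using k elim by (simp add: exp_minus eL field_simps)
        also have "\<dots> = n * exp (- (5/4) * u (4/5 * L) powr b)" using L by (simp add: upow)
        also have "\<dots> \<le> n * G (- u (4/5 * L))" using G y0 by (intro mult_left_mono) auto
        finally show ?thesis .
      qed
      moreover have "real n ^ 2 * (32 * C\<^sup>2 * exp (- (3/2) * u (4 * L) powr b)) \<le> exp (- 4)"
      proof -
        have "real n ^ 2 = sqrt n ^ 4" by (simp add: power4_eq_xxxx power2_eq_square)
        also have "\<dots> \<le> (D * exp L) ^ 4" using sq' by (intro power_mono) auto
        finally have "real n ^ 2 * (32 * C\<^sup>2 * exp (- (3/2) * u (4 * L) powr b)) \<le>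
            (D * exp L) ^ 4 * (32 * C\<^sup>2 * exp (- (3/2) * u (4 * L) powr b))"
          by (intro mult_right_mono) auto
        also have "\<dots> = D ^ 4 * 32 * C\<^sup>2 * (exp (4 * L) * exp (- 6 * L))"
          using L by (simp add: upow power_mult_distrib exp_of_nat_mult[symmetric])
        also have "exp (4 * L) * exp (- 6 * L) = exp (- 2 * L)" by (simp add: mult_exp_exp)
        finally show ?thesis using one by linarith
      qed
      moreover have "exp 1 * n * (32 * C\<^sup>2 * exp (- (3/2) * u (3/4 * L) powr b)) / (r * k) \<le> exp (- (1 / r))"
      proof -
        have "exp 1 * n * (32 * C\<^sup>2 * exp (- (3/2) * u (3/4 * L) powr b)) / (r * k) =
            exp 1 * 32 * C\<^sup>2 / r * (exp L * exp (- (9/8) * L))"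
          using L by (simp add: upow eL)
        also have "exp L * exp (- (9/8) * L) = exp (- (1/8) * L)" by (simp add: mult_exp_exp)
        finally show ?thesis using two by linarith
      qed
      ultimately show "\<exists>w v B r :: real. 0 \<le> w \<and> w < v \<and> v < B \<and> r = (v - w) / (4 * (B - w)) \<and> k \<le> n * G (- v) \<and>
          real n ^ 2 * (32 * C\<^sup>2 * exp (- (3/2) * B powr b)) \<le> exp (- 4) \<and>
          exp 1 * n * (32 * C\<^sup>2 * exp (- (3/2) * w powr b)) / (r * k) \<le> exp (- (1 / r))"
        by blast
    qed
  qed
qed

section \<open>The distribution of the support size\<close>

text \<open>
  A large support forces one of three events: all diagonal entries exceed \<open>- v\<close>, at least
  \<open>k / 4\<close> pairs have an entry at most \<open>- B\<close>, or some column has many entries at most \<open>- w\<close>. The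
  hypotheses \<open>diag\<close>, \<open>pairs\<close> and \<open>column\<close> make them improbable.
\<close>

lemma (in prob_space) prob_large_support:
  fixes A :: "'a \<Rightarrow> nat \<Rightarrow> nat \<Rightarrow> real" and x :: "'a \<Rightarrow> nat \<Rightarrow> real"
    and r v w B C b :: real and G :: "real \<Rightarrow> real" and k :: nat
  assumes ind: "indep_vars (\<lambda>_. borel) (\<lambda>(i, j) \<omega>. A \<omega> i j) ({..<n} \<times> {..<n})"
    and cdf: "\<And>i j y. i < n \<Longrightarrow> j < n \<Longrightarrow> prob {\<omega> \<in> space M. A \<omega> i j \<le> y} = G y"
    and min: "\<And>\<omega>. \<omega> \<in> space M \<Longrightarrow> global_minimizer n (sym_part (A \<omega>)) (x \<omega>)"
    and G: "\<And>y. 0 \<le> y \<Longrightarrow> G (- y) \<le> C * exp (- (7/8) * y powr b)" and C: "1 \<le> C" and b: "b > 1"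
    and n: "n \<ge> 1" and k: "k \<ge> 1" and w: "0 \<le> w" "w < v" "v < B"
    and r: "r = (v - w) / (4 * (B - w))"
    and diag: "k \<le> n * G (- v)"
    and pairs: "real n ^ 2 * (32 * C\<^sup>2 * exp (- (3/2) * B powr b)) \<le> exp (- 4)"
    and column: "exp 1 * n * (32 * C\<^sup>2 * exp (- (3/2) * w powr b)) / (r * k) \<le> exp (- (1 / r))"
    and S: "\<And>\<omega>. \<omega> \<in> S \<Longrightarrow> \<omega> \<in> space M \<and> k + 1 \<le> support_size n (x \<omega>)"
  shows "prob S \<le> 3 * real n * exp (- real k)"
proof -
  define X where "X = (\<lambda>(i, j) \<omega>. A \<omega> i j)"
  have indX: "indep_vars (\<lambda>_. borel) X ({..<n} \<times> {..<n})" using ind by (simp add: X_def)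
  have cdfX: "prob {\<omega> \<in> space M. X q \<omega> \<le> y} = G y" if "q \<in> {..<n} \<times> {..<n}" for q y
    using that cdf by (auto simp: X_def)
  have avg: "prob {\<omega> \<in> space M. (X (i, j) \<omega> + X (j, i) \<omega>) / 2 \<le> - y} \<le> 32 * C\<^sup>2 * exp (- (3/2) * y powr b)"
    if "i < n" "j < n" "i \<noteq> j" "0 \<le> y" for i j y
    using that by (intro prob_average_tail[OF indX _ _ _ cdfX G C b]) auto
  have r0: "r > 0" using w by (simp add: r)
  define S0 where "S0 = {\<omega> \<in> space M. \<forall>l<n. - v < X (l, l) \<omega>}"
  define m where "m = nat \<lceil>real k / 4\<rceil>"
  have m: "real k / 4 \<le> real m" by (simp add: m_def)
  define S1 where "S1 = {\<omega> \<in> space M. m \<le> card {q \<in> {(i, j). i < j \<and> j < n}.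
      (X q \<omega> + X (snd q, fst q) \<omega>) / 2 \<le> - B}}"
  define S2 where "S2 j = {\<omega> \<in> space M. r * real k \<le> card {i \<in> {i. i < n \<and> i \<noteq> j}.
      (X (i, j) \<omega> + X (j, i) \<omega>) / 2 \<le> - w}}" for j
  have S0: "S0 \<in> events" "prob S0 \<le> exp (- real n * G (- v))"
    unfolding S0_def by (rule prob_no_small_diag[OF indX cdfX n]; assumption)+
  have avgB: "prob {\<omega> \<in> space M. (X (i, j) \<omega> + X (j, i) \<omega>) / 2 \<le> - B} \<le> 32 * C\<^sup>2 * exp (- (3/2) * B powr b)"
    if "i < n" "j < n" "i \<noteq> j" for i j
    using w by (intro avg that) linarith
  have avgw: "prob {\<omega> \<in> space M. (X (i, j) \<omega> + X (j, i) \<omega>) / 2 \<le> - w} \<le> 32 * C\<^sup>2 * exp (- (3/2) * w powr b)"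
    if "i < n" "j < n" "i \<noteq> j" for i j
    by (intro avg that w)
  have p0: "0 \<le> 32 * C\<^sup>2 * exp (- (3/2) * y powr b)" for y by simp
  note small_pairs = prob_many_small_pairs[OF indX avgB p0 pairs m, folded S1_def]
  have S1: "S1 \<in> events" "prob S1 \<le> exp (- real k)"
    by (rule small_pairs; assumption)+
  have k0: "0 < k" using k by simp
  note dense = prob_dense_column[OF indX avgw p0 r0 k0 column, folded S2_def]
  have S2: "S2 j \<in> events" "prob (S2 j) \<le> exp (- real k)" if "j < n" for j
    by (rule dense; (assumption | rule that))+
  have "S \<subseteq> S0 \<union> S1 \<union> (\<Union>j<n. S2 j)"
  proof
    fix \<omega> assume "\<omega> \<in> S"
    then have w': "\<omega> \<in> space M" "k + 1 \<le> support_size n (x \<omega>)" using S by auto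
    show "\<omega> \<in> S0 \<union> S1 \<union> (\<Union>j<n. S2 j)"
    proof (rule ccontr)
      assume neg: "\<omega> \<notin> S0 \<union> S1 \<union> (\<Union>j<n. S2 j)"
      let ?Q = "sym_part (A \<omega>)"
      obtain l where l: "l < n" "?Q l l \<le> - v"
        using neg w' by (auto simp: S0_def X_def sym_part_def not_less)
      have "card {q \<in> {(i, j). i < j \<and> j < n}. ?Q (fst q) (snd q) \<le> - B} < m"
        using neg w' by (auto simp: S1_def X_def sym_part_def not_le case_prod_beta)
      then have few: "real (card {q \<in> {(i, j). i < j \<and> j < n}. ?Q (fst q) (snd q) \<le> - B}) < k / 4"
        unfolding m_def by linarith
      have sym: "?Q i j = ?Q j i" for i j by (simp add: sym_part_def add.commute)
      obtain j where "j < n" "r * k \<le> card {i \<in> {i. i < n \<and> i \<noteq> j}. ?Q i j \<le> - w}"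
        unfolding r using dense_column[where Q = ?Q, OF min[OF w'(1)] sym w'(2) l w(2,3) few] by blast
      then show False using neg w' by (auto simp: S2_def X_def sym_part_def)
    qed
  qed
  then have "prob S \<le> prob (S0 \<union> S1 \<union> (\<Union>j<n. S2 j))"
    using S0 S1 S2 by (intro finite_measure_mono) auto
  also have "\<dots> \<le> prob (S0 \<union> S1) + prob (\<Union>j<n. S2 j)"
    using S0 S1 S2 by (intro measure_Un_le) auto
  also have "\<dots> \<le> (prob S0 + prob S1) + (\<Sum>j<n. prob (S2 j))"
    using S0 S1 S2 by (intro add_mono measure_Un_le finite_measure_subadditive_finite) auto
  also have "\<dots> \<le> (exp (- real k) + exp (- real k)) + (\<Sum>j<n. exp (- real k))"
  proof (intro add_mono sum_mono)
    have "exp (- real n * G (- v)) \<le> exp (- real k)" using diag by simp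
    then show "prob S0 \<le> exp (- real k)" using S0 by linarith
  qed (use S1 S2 in auto)
  also have "\<dots> = (2 + real n) * exp (- real k)" by (simp add: algebra_simps)
  also have "\<dots> \<le> (3 * real n) * exp (- real k)" using n by (intro mult_right_mono) auto
  finally show ?thesis .
qed

lemma support_tail_bound:
  fixes P :: "nat \<Rightarrow> 'a measure"
    and M :: "nat \<Rightarrow> 'a \<Rightarrow> nat \<Rightarrow> nat \<Rightarrow> real"
    and X :: "nat \<Rightarrow> 'a \<Rightarrow> nat \<Rightarrow> real"
    and G :: "real \<Rightarrow> real" and a b c \<kappa> \<alpha> :: real
  assumes ps: "\<And>n. n \<ge> 1 \<Longrightarrow> prob_space (P n)"
    and ind: "\<And>n. n \<ge> 1 \<Longrightarrow>
      prob_space.indep_vars (P n) (\<lambda>_. borel) (\<lambda>(i, j) \<omega>. M n \<omega> i j) ({..<n} \<times> {..<n})"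
    and cdf: "\<And>n i j. i < n \<Longrightarrow> j < n \<Longrightarrow> cdf (distr (P n) borel (\<lambda>\<omega>. M n \<omega> i j)) = G"
    and min: "\<And>n \<omega>. n \<ge> 1 \<Longrightarrow> \<omega> \<in> space (P n) \<Longrightarrow>
      global_minimizer n (sym_part (M n \<omega>)) (X n \<omega>)"
    and c: "c > 0" and kap: "\<kappa> > 0" and b: "b > 1" and tail: "left_tail G c \<kappa> a b" and al: "\<alpha> > 0"
  shows "\<forall>\<^sub>F n in sequentially. \<forall>k S. 1 \<le> k \<longrightarrow> k \<le> k_max \<alpha> n \<longrightarrow>
    S \<subseteq> {\<omega> \<in> space (P n). k + 1 \<le> support_size n (X n \<omega>)} \<longrightarrow>
    measure (P n) S \<le> 3 * real n * exp (- real k)"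
proof -
  have G_eq: "measure (P n) {\<omega> \<in> space (P n). M n \<omega> i j \<le> y} = G y" if "i < n" "j < n" for n i j y
  proof -
    interpret prob_space "P n" using ps that by simp
    have "n \<ge> 1" using that by simp
    then have "indep_vars (\<lambda>_. borel) (\<lambda>(i, j) \<omega>. M n \<omega> i j) ({..<n} \<times> {..<n})" by (rule ind)
    then have "random_variable borel ((\<lambda>(i, j) \<omega>. M n \<omega> i j) (i, j))"
      unfolding indep_vars_def using that by blast
    then have rv: "(\<lambda>\<omega>. M n \<omega> i j) \<in> borel_measurable (P n)" by simp
    have "G y = measure (distr (P n) borel (\<lambda>\<omega>. M n \<omega> i j)) {..y}"
      unfolding cdf[OF that, symmetric] cdf_def ..
    also have "\<dots> = measure (P n) ((\<lambda>\<omega>. M n \<omega> i j) -` {..y} \<inter> space (P n))"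
      using rv by (intro measure_distr) auto
    also have "(\<lambda>\<omega>. M n \<omega> i j) -` {..y} \<inter> space (P n) = {\<omega> \<in> space (P n). M n \<omega> i j \<le> y}" by auto
    finally show ?thesis by simp
  qed
  have G1: "G y \<le> 1" for y
    unfolding G_eq[of 0 1 0 y, OF zero_less_one zero_less_one, symmetric]
    by (rule prob_space.prob_le_1[OF ps]) simp
  obtain y0 where y0: "y0 > 0" and lo: "\<forall>y\<ge>y0. exp (- (5/4) * y powr b) \<le> G (- y)"
    and hi: "\<And>y. y \<ge> y0 \<Longrightarrow> G (- y) \<le> exp (- (7/8) * y powr b)"
    using left_tail_bounds[OF tail c kap b] by blast
  \<comment> \<open>The factor \<open>C\<close> extends the upper bound to \<open>0 \<le> y \<le> y0\<close>, where only \<open>G \<le> 1\<close> is known.\<close>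
  define C where "C = exp ((7/8) * y0 powr b)"
  have C: "1 \<le> C" by (simp add: C_def)
  have up: "G (- y) \<le> C * exp (- (7/8) * y powr b)" if "0 \<le> y" for y
  proof (cases "y \<le> y0")
    case True
    then have "y powr b \<le> y0 powr b" using that b by (intro powr_mono2) auto
    then have "1 \<le> C * exp (- (7/8) * y powr b)" by (simp add: C_def mult_exp_exp)
    with G1[of "- y"] show ?thesis by linarith
  next
    case False
    then have "G (- y) \<le> 1 * exp (- (7/8) * y powr b)" using hi[of y] by simp
    also have "\<dots> \<le> C * exp (- (7/8) * y powr b)" using C by (intro mult_right_mono) auto
    finally show ?thesis .
  qed
  have "\<forall>\<^sub>F n in sequentially. n \<ge> (1::nat)" by (rule eventually_ge_at_top)
  with eventually_thresholds[OF lo b C al] show ?thesis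
  proof eventually_elim
    case (elim n)
    interpret prob_space "P n" using ps elim(2) .
    show ?case
    proof (intro allI impI)
      fix k S assume k: "1 \<le> k" "k \<le> k_max \<alpha> n"
        and S: "S \<subseteq> {\<omega> \<in> space (P n). k + 1 \<le> support_size n (X n \<omega>)}"
      obtain w v B r :: real where par: "0 \<le> w" "w < v" "v < B" "r = (v - w) / (4 * (B - w))"
        "k \<le> n * G (- v)"
        "real n ^ 2 * (32 * C\<^sup>2 * exp (- (3/2) * B powr b)) \<le> exp (- 4)"
        "exp 1 * n * (32 * C\<^sup>2 * exp (- (3/2) * w powr b)) / (r * k) \<le> exp (- (1 / r))"
        using elim(1)[rule_format, OF k] by (elim exE conjE) (rule that)
      show "prob S \<le> 3 * real n * exp (- real k)"
        by (rule prob_large_support[where x = "X n", OF ind[OF elim(2)] G_eq min[OF elim(2)] up C b elim(2) k(1) par])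
          (use S in \<open>assumption | blast\<close>)+
    qed
  qed
qed

text \<open>
  For \<open>k\<close> about \<open>2 ln n\<close> the tail bound is \<open>3 / n\<close>, and such \<open>k\<close> lies below both \<open>k_max\<close> and
  any diverging multiple of \<open>ln n\<close>.
\<close>

lemma bigO_prob_log_powr:
  assumes al: "\<alpha> > 0" and e: "e \<ge> 1"
    and tail: "\<forall>\<^sub>F n in sequentially. \<forall>k S. 1 \<le> k \<longrightarrow> k \<le> k_max \<alpha> n \<longrightarrow>
      S \<subseteq> {\<omega> \<in> space (P n). k + 1 \<le> K n \<omega>} \<longrightarrow>
      measure (P n) S \<le> 3 * real n * exp (- real k)"
  shows "bigO_prob P (\<lambda>n \<omega>. real (K n \<omega> :: nat)) (\<lambda>n. ln (real n) powr e)"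
  unfolding bigO_prob_def
proof (intro allI impI)
  fix w :: "nat \<Rightarrow> real" assume w: "filterlim w at_top sequentially"
  have w4: "\<forall>\<^sub>F n in sequentially. 4 \<le> w n" using w by (simp add: filterlim_at_top)
  have ln1: "\<forall>\<^sub>F n in sequentially. 1 \<le> ln (real n)" by real_asymp
  have small: "\<forall>\<^sub>F n in sequentially. 2 * ln (real n) + 1 \<le> \<alpha> * sqrt (real n)" using al by real_asymp
  have pos: "\<forall>\<^sub>F n in sequentially. n \<ge> (1::nat)" by (rule eventually_ge_at_top)
  have "\<forall>\<^sub>F n in sequentially.
      measure (P n) {\<omega> \<in> space (P n). real (K n \<omega>) > w n * ln (real n) powr e} \<le> 3 / real n"
    using tail w4 ln1 small pos
  proof eventually_elim
    case (elim n)
    define k where "k = nat \<lceil>2 * ln (real n)\<rceil>"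
    have k: "2 * ln (real n) \<le> real k" "real k < 2 * ln (real n) + 1"
      using elim(3) ceiling_correct[of "2 * ln (real n)"] unfolding k_def by simp_all
    have "0 < real k" using k(1) elim(3) by linarith
    then have "1 \<le> k" by simp
    moreover have "k \<le> k_max \<alpha> n"
      using k(2) elim(4) real_nat_ceiling_ge[of "\<alpha> * sqrt (real n)"]
      unfolding k_max_def of_nat_le_iff[where 'a = real, symmetric] by linarith
    moreover have "{\<omega> \<in> space (P n). real (K n \<omega>) > w n * ln (real n) powr e} \<subseteq>
        {\<omega> \<in> space (P n). k + 1 \<le> K n \<omega>}"
    proof -
      have "real k + 1 \<le> 4 * ln (real n)" using k(2) elim(3) by linarith
      also have "\<dots> = 4 * ln (real n) powr 1" using elim(3) by simp
      also have "\<dots> \<le> w n * ln (real n) powr e"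
        using elim(2,3) e by (intro mult_mono powr_mono) auto
      finally have "real k + 1 \<le> w n * ln (real n) powr e" .
      then show ?thesis by auto
    qed
    ultimately have "measure (P n) {\<omega> \<in> space (P n). real (K n \<omega>) > w n * ln (real n) powr e}
        \<le> 3 * real n * exp (- real k)"
      by (rule elim(1)[rule_format])
    also have "\<dots> \<le> 3 * real n * exp (- (2 * ln (real n)))"
      using k(1) by (intro mult_left_mono) auto
    also have "\<dots> = 3 / real n"
    proof -
      have "exp (2 * ln (real n)) = exp (ln (real n)) ^ 2" by (rule exp_double)
      then have "exp (2 * ln (real n)) = real n ^ 2" using elim(5) by simp
      then show ?thesis using elim(5) by (simp add: exp_minus power2_eq_square divide_inverse)
    qed
    finally show ?case .
  qed
  note upper = this
  have lim: "(\<lambda>n. 3 / real n) \<longlonglongrightarrow> 0" by real_asymp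
  show "(\<lambda>n. measure (P n) {\<omega> \<in> space (P n). real (K n \<omega>) > w n * ln (real n) powr e}) \<longlonglongrightarrow> 0"
    by (rule tendsto_sandwich[OF always_eventually upper tendsto_const lim]) (simp add: measure_nonneg)
qed

theorem theorem3p12:
  fixes P :: "nat \<Rightarrow> 'a measure"
    and M :: "nat \<Rightarrow> 'a \<Rightarrow> nat \<Rightarrow> nat \<Rightarrow> real"
    and X :: "nat \<Rightarrow> 'a \<Rightarrow> nat \<Rightarrow> real"
    and G g :: "real \<Rightarrow> real"
    and a b c \<kappa> \<alpha> a' :: real
    and K :: "nat \<Rightarrow> 'a \<Rightarrow> nat"
  assumes "\<And>n. n \<ge> 1 \<Longrightarrow> prob_space (P n)"
    and "\<And>n. n \<ge> 1 \<Longrightarrow>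
      prob_space.indep_vars (P n) (\<lambda>_. borel) (\<lambda>(i, j) \<omega>. M n \<omega> i j) ({..<n} \<times> {..<n})"
    and "\<And>n i j. i < n \<Longrightarrow> j < n \<Longrightarrow> cdf (distr (P n) borel (\<lambda>\<omega>. M n \<omega> i j)) = G"
    and "continuous_on UNIV G"
    and "\<And>n j. j < n \<Longrightarrow> (\<lambda>\<omega>. X n \<omega> j) \<in> borel_measurable (P n)"
    and "\<And>n \<omega>. n \<ge> 1 \<Longrightarrow> \<omega> \<in> space (P n) \<Longrightarrow>
      global_minimizer n (sym_part (M n \<omega>)) (X n \<omega>)"
    and "\<And>n \<omega>. K n \<omega> = support_size n (X n \<omega>)"
    and "c > 0" and "\<kappa> > 0" and "b > 1"
    and "left_tail G c \<kappa> a b"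
    and "\<forall>\<^sub>F x in at_bot. (G has_real_derivative g x) (at x)"
    and "left_tail g (c * b) \<kappa> (a + b - 1) b"
    and "a' = 2 * a + b / 2"
    and "\<alpha> > exp 1 * sqrt 2"
  shows "(\<exists>C. \<forall>\<^sub>F n in sequentially. \<forall>k\<le>k_max \<alpha> n.
            measure (P n) {\<omega> \<in> space (P n). K n \<omega> = k + 1}
              \<le> C * (real n * (8 / 9) powr (real k / 4)
                     + real n * exp (- (real k * ln (real n / real k) powr (min 0 (a' / b))
                                          / (2 * exp 1)))))
       \<and> bigO_prob P (\<lambda>n \<omega>. real (K n \<omega>))
            (\<lambda>n. ln (real n) powr (max 1 (1 / 2 - 2 * a / b)))
       \<and> (a = -1 \<and> b = 2 \<longrightarrow>
            bigO_prob P (\<lambda>n \<omega>. real (K n \<omega>)) (\<lambda>n. ln (real n) powr (3 / 2)))"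
proof -
  have al: "\<alpha> > 0" using assms(15) by (rule order.strict_trans[rotated]) simp
  have tail: "\<forall>\<^sub>F n in sequentially. \<forall>k S. 1 \<le> k \<longrightarrow> k \<le> k_max \<alpha> n \<longrightarrow>
      S \<subseteq> {\<omega> \<in> space (P n). k + 1 \<le> K n \<omega>} \<longrightarrow>
      measure (P n) S \<le> 3 * real n * exp (- real k)"
    unfolding assms(7)
    by (rule support_tail_bound[OF assms(1-3) assms(6) assms(8-11) al])
  have bigO: "bigO_prob P (\<lambda>n \<omega>. real (K n \<omega>)) (\<lambda>n. ln (real n) powr e)" if "e \<ge> 1" for e
    by (rule bigO_prob_log_powr[OF al that tail])
  have "\<forall>\<^sub>F n in sequentially. n \<ge> (1::nat)" by (rule eventually_ge_at_top)
  with tail have "\<forall>\<^sub>F n in sequentially. \<forall>k\<le>k_max \<alpha> n.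
      measure (P n) {\<omega> \<in> space (P n). K n \<omega> = k + 1}
        \<le> 3 * (real n * (8 / 9) powr (real k / 4)
               + real n * exp (- (real k * ln (real n / real k) powr (min 0 (a' / b))
                                    / (2 * exp 1))))"
  proof eventually_elim
    case (elim n)
    interpret prob_space "P n" using assms(1) elim(2) .
    show ?case
    proof (intro allI impI)
      fix k assume k: "k \<le> k_max \<alpha> n"
      have "prob {\<omega> \<in> space (P n). K n \<omega> = k + 1} \<le> 3 * real n * exp (- real k)"
      proof (cases "k = 0")
        case True
        then show ?thesis
          using elim(2) prob_le_1[of "{\<omega> \<in> space (P n). K n \<omega> = k + 1}"]
          by (simp add: order_trans[of _ "1 :: real"])
      next
        case False
        then show ?thesis using k by (intro elim(1)[rule_format]) auto
      qed
      moreover have "exp (- real k) \<le> (8 / 9) powr (real k / 4)"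
      proof -
        \<comment> \<open>\<open>ln (9/8) \<le> 1/8\<close>, well below the required bound 4.\<close>
        have "- 1 \<le> ln (8 / 9 :: real) / 4"
          using ln_add_one_self_le_self[of "1 / 8"] ln_inverse[of "8 / 9 :: real"] by simp
        then have "real k * (- 1) \<le> real k * (ln (8 / 9 :: real) / 4)" by (intro mult_left_mono) auto
        then show ?thesis by (simp add: powr_def)
      qed
      then have "3 * real n * exp (- real k) \<le> 3 * (real n * (8 / 9) powr (real k / 4))"
        by (simp add: mult_left_mono)
      ultimately have "prob {\<omega> \<in> space (P n). K n \<omega> = k + 1} \<le> 3 * (real n * (8 / 9) powr (real k / 4))"
        by linarith
      also have "\<dots> \<le> 3 * (real n * (8 / 9) powr (real k / 4)
               + real n * exp (- (real k * ln (real n / real k) powr (min 0 (a' / b))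
                                    / (2 * exp 1))))"
        by simp
      finally show "prob {\<omega> \<in> space (P n). K n \<omega> = k + 1} \<le> 3 * (real n * (8 / 9) powr (real k / 4)
               + real n * exp (- (real k * ln (real n / real k) powr (min 0 (a' / b))
                                    / (2 * exp 1))))" .
    qed
  qed
  then show ?thesis by (intro conjI[OF exI conjI[OF bigO impI[OF bigO]]]) (assumption, simp_all)
qed

end
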